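(* Let $\psi:\mathbb{R}^m\times\mathbb{R}^m\times M^{n\times n}_+\to[0,\infty)$. The identity $$\int_{\Omega_1}\psi(c_1(x),c_2(y(x)),R_2Dy(x)R_1^T)\,dx=\int_{\Omega_1}\psi(c_1(x),c_2(y(x)),Dy(x))\,dx$$ holds for all $R_1,R_2\in SO(n)$, all images $P_1=(\Omega_1,c_1)$, $P_2=(\Omega_2,c_2)$, and all orientation-preserving invertible $y:\Omega_1\to\Omega_2$ with $y(\Omega_1)=\Omega_2$, if and only if $\psi(c_1,c_2,\cdot)$ is isotropic, i.e. $$\psi(c_1,c_2,QAR)=\psi(c_1,c_2,A)\quad\text{for all }c_1,c_2\in\mathbb{R}^m,\ A\in M^{n\times n}_+,\ Q,R\in SO(n).$$
   Context: $M^{n\times n}_+$ denotes the set of real $n\times n$ matrices with positive determinant. An image is a pair $P=(\Omega,c)$ with $\Omega\subset\mathbb{R}^n$ a bounded Lipschitz domain and $c:\Omega\to\mathbb{R}^m$ a (measurable) intensity map. $Dy$ is the distributional gradient of $y$. An orientation-preserving invertible map $y$ with $y(\Omega_1)=\Omega_2$ means a homeomorphism $y:\Omega_1\to\Omega_2$ with $y\in W^{1,p}(\Omega_1,\mathbb{R}^n)$ and $y^{-1}\in W^{1,p}(\Omega_2,\mathbb{R}^n)$ for some fixed exponent $p>n$, and $\det Dy(x)>0$ for a.e. $x\in\Omega_1$. The function $\psi$ is taken to be Borel measurable so that the integrals (with values in $[0,\infty]$) are defined. *)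

theory Defs
  imports "HOL-Analysis.Analysis"
begin

definition Mplus :: "(real^'n^'n) set" where
  "Mplus = {A. det A > 0}"

definition isotropic :: "(real^'n^'n \<Rightarrow> real) \<Rightarrow> bool" where
  "isotropic f \<longleftrightarrow>
     (\<forall>A\<in>Mplus. \<forall>Q R. rotation_matrix Q \<longrightarrow> rotation_matrix R \<longrightarrow> f (Q ** A ** R) = f A)"

(* Near each boundary point the domain is the strict epigraph of a Lipschitz function.
   The unit vector e is the "vertical" direction; x - (x \<bullet> e) *\<^sub>R e is the orthogonal projection
   of x onto the hyperplane of "horizontal" coordinates, which plays the role of R^(n-1). *)
definition lipschitz_domain :: "(real^'n) set \<Rightarrow> bool" where
  "lipschitz_domain \<Omega> \<longleftrightarrow>
     \<Omega> \<noteq> {} \<and> open \<Omega> \<and> connected \<Omega> \<and>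
     (\<forall>x0\<in>frontier \<Omega>. \<exists>r>0. \<exists>e \<gamma> L. norm e = 1 \<and> L-lipschitz_on {z. z \<bullet> e = 0} \<gamma> \<and>
        \<Omega> \<inter> ball x0 r = {x \<in> ball x0 r. \<gamma> (x - (x \<bullet> e) *\<^sub>R e) < x \<bullet> e})"

definition is_image :: "(real^'n) set \<Rightarrow> (real^'n \<Rightarrow> real^'m) \<Rightarrow> bool" where
  "is_image \<Omega> c \<longleftrightarrow>
     bounded \<Omega> \<and> lipschitz_domain \<Omega> \<and> c \<in> borel_measurable (lebesgue_on \<Omega>)"

primrec C_k :: "nat \<Rightarrow> (real^'n \<Rightarrow> real) \<Rightarrow> bool" where
  "C_k 0 f \<longleftrightarrow> continuous_on UNIV f"
| "C_k (Suc k) f \<longleftrightarrow> (\<forall>x. f differentiable (at x)) \<and>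
     (\<forall>j. C_k k (\<lambda>x. frechet_derivative f (at x) (axis j 1)))"

definition test_function :: "(real^'n) set \<Rightarrow> (real^'n \<Rightarrow> real) \<Rightarrow> bool" where
  "test_function \<Omega> \<phi> \<longleftrightarrow>
     (\<forall>k. C_k k \<phi>) \<and> compact (closure {x. \<phi> x \<noteq> 0}) \<and> closure {x. \<phi> x \<noteq> 0} \<subseteq> \<Omega>"

definition locally_integrable_on :: "('a::euclidean_space \<Rightarrow> 'b::euclidean_space) \<Rightarrow> 'a set \<Rightarrow> bool"
    (infixr "locally'_integrable'_on" 46) where
  "f locally_integrable_on \<Omega> \<longleftrightarrow>
     (\<forall>K. compact K \<and> K \<subseteq> \<Omega> \<longrightarrow> f absolutely_integrable_on K)"

(* G is a representative of the distributional gradient Dy of y on \<Omega>;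
   the entry in row i and column j is the j-th partial derivative of the i-th component.
   It determines G up to a Lebesgue null subset of \<Omega>. *)
definition is_weak_gradient ::
    "(real^'n) set \<Rightarrow> (real^'n \<Rightarrow> real^'k) \<Rightarrow> (real^'n \<Rightarrow> real^'n^'k) \<Rightarrow> bool" where
  "is_weak_gradient \<Omega> y G \<longleftrightarrow>
     y locally_integrable_on \<Omega> \<and> G locally_integrable_on \<Omega> \<and>
     (\<forall>\<phi> i j. test_function \<Omega> \<phi> \<longrightarrow>
        (LINT x|lebesgue_on \<Omega>. y x $ i * frechet_derivative \<phi> (at x) (axis j 1)) =
        - (LINT x|lebesgue_on \<Omega>. G x $ i $ j * \<phi> x))"

definition in_Lp :: "real \<Rightarrow> 'a::euclidean_space set \<Rightarrow> ('a \<Rightarrow> 'b::euclidean_space) \<Rightarrow> bool" where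
  "in_Lp p \<Omega> f \<longleftrightarrow>
     f \<in> borel_measurable (lebesgue_on \<Omega>) \<and> integrable (lebesgue_on \<Omega>) (\<lambda>x. norm (f x) powr p)"

definition in_W1p :: "real \<Rightarrow> (real^'n) set \<Rightarrow> (real^'n \<Rightarrow> real^'k) \<Rightarrow> bool" where
  "in_W1p p \<Omega> y \<longleftrightarrow> in_Lp p \<Omega> y \<and> (\<exists>G. is_weak_gradient \<Omega> y G \<and> in_Lp p \<Omega> G)"

(* The inverse of y is the map z; only its values on \<Omega>2 matter. The argument Dy is a
   representative of the distributional gradient of y. *)
definition orientation_preserving_invertible ::
    "real \<Rightarrow> (real^'n) set \<Rightarrow> (real^'n) set \<Rightarrow> (real^'n \<Rightarrow> real^'n) \<Rightarrow> (real^'n \<Rightarrow> real^'n^'n) \<Rightarrow> bool" where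
  "orientation_preserving_invertible p \<Omega>1 \<Omega>2 y Dy \<longleftrightarrow>
     (\<exists>z. homeomorphism \<Omega>1 \<Omega>2 y z \<and> in_W1p p \<Omega>1 y \<and> in_W1p p \<Omega>2 z) \<and>
     is_weak_gradient \<Omega>1 y Dy \<and>
     (AE x in lebesgue_on \<Omega>1. det (Dy x) > 0)"

end

theory Submission
  imports Defs
begin

text \<open>Isotropy makes the two integrands agree almost everywhere. Conversely, for \<open>A\<close> with positive
  determinant, test the identity with the linear map \<open>x \<mapsto> A x\<close> on the unit ball and constant
  intensity maps: both integrands are then constant. This map is admissible: the
  ellipsoid \<open>A (ball 0 1)\<close> is a Lipschitz domain because it is convex, and \<open>A\<close> is the distributional
  gradient of \<open>x \<mapsto> A x\<close> by integration by parts.\<close>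

section \<open>Integrals of derivatives of compactly supported functions\<close>

lemma integrable_continuous_compact_support:
  fixes f :: "'a::euclidean_space \<Rightarrow> 'b::euclidean_space"
  assumes "continuous_on UNIV f" and "compact K" and "\<And>x. x \<notin> K \<Longrightarrow> f x = 0"
  shows "integrable lborel f"
proof -
  have "integrable lborel (\<lambda>x. indicator K x *\<^sub>R f x)"
    using assms by (intro borel_integrable_compact) (auto intro: continuous_on_subset)
  moreover have "(\<lambda>x. indicator K x *\<^sub>R f x) = f"
    using assms(3) by (auto simp: indicator_def fun_eq_iff)
  ultimately show ?thesis by simp
qed

text \<open>The complement of \<open>K\<close> is open, so \<open>f\<close> vanishes on a whole
  neighbourhood of \<open>x\<close>. Thus derivatives inherit the support of the function.\<close>

lemma has_derivative_zero_outside_closed: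
  assumes "closed K" and "\<And>x. x \<notin> K \<Longrightarrow> f x = 0" and "(f has_derivative f') (at x)" and "x \<notin> K"
  shows "f' = (\<lambda>_. 0)"
proof -
  have "(f has_derivative (\<lambda>_. 0)) (at x)"
    by (rule has_derivative_transform_within_open[of "\<lambda>_. 0" _ _ _ "- K"]) (use assms in auto)
  then show ?thesis using assms(3) has_derivative_unique by blast
qed

text \<open>The difference quotients of \<open>g\<close> have vanishing integral by translation invariance, and
  they converge dominatedly to the directional derivative.\<close>

lemma integral_directional_derivative_eq_0:
  fixes g :: "'a::euclidean_space \<Rightarrow> real"
  assumes der: "\<And>x. (g has_derivative g' x) (at x)"
    and cont: "continuous_on UNIV (\<lambda>x. g' x b)"
    and K: "compact K" and zero: "\<And>x. x \<notin> K \<Longrightarrow> g x = 0"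
  shows "integral\<^sup>L lborel (\<lambda>x. g' x b) = 0"
proof -
  have gcont: "continuous_on UNIV g"
    by (intro continuous_at_imp_continuous_on ballI has_derivative_continuous[OF der])
  have zero': "g' x b = 0" if "x \<notin> K" for x
    using has_derivative_zero_outside_closed[OF compact_imp_closed[OF K] zero der[of x] that] by simp
  have "bounded ((\<lambda>x. g' x b) ` K)"
    by (intro compact_imp_bounded compact_continuous_image continuous_on_subset[OF cont] K) auto
  then obtain B where B: "B > 0" "\<And>x. x \<in> K \<Longrightarrow> \<bar>g' x b\<bar> \<le> B"
    unfolding bounded_pos by auto
  have B': "\<bar>g' x b\<bar> \<le> B" for x
    using B zero'[of x] by (cases "x \<in> K") auto
  obtain R where R: "\<And>x. x \<in> K \<Longrightarrow> norm x \<le> R"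
    using compact_imp_bounded[OF K] unfolding bounded_pos by blast
  \<comment> \<open>Steps of size at most 1 keep the supports of all difference quotients within one
    ball, whose indicator can then serve in the majorant.\<close>
  define h where "h n = inverse (real (Suc n))" for n
  have h: "h n > 0" "h n \<le> 1" for n
    by (auto simp: h_def divide_simps)
  have h0: "h \<longlonglongrightarrow> 0"
    unfolding h_def by (rule LIMSEQ_inverse_real_of_nat)
  define s where "s n x = (g (x + h n *\<^sub>R b) - g x) / h n" for n x
  have line: "((\<lambda>t. g (x + t *\<^sub>R b)) has_derivative (\<lambda>u. g' (x + t *\<^sub>R b) (u *\<^sub>R b))) (at t within S)" for x t S
    by (rule has_derivative_compose[OF _ der]) (auto intro!: derivative_eq_intros)
  have lin: "g' x (u *\<^sub>R b) = u * g' x b" for x u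
    using linear_simps(5)[OF has_derivative_bounded_linear[OF der]] by simp
  \<comment> \<open>Inside the ball the mean value theorem turns the quotient into a value of the
    directional derivative. Outside it, neither \<open>x\<close> nor the shifted point can lie in
    \<open>K\<close>, so the quotient is 0.\<close>
  have bnd: "norm (s n x) \<le> B * indicator (cball 0 (R + norm b)) x" for n x
  proof (cases "x \<in> cball 0 (R + norm b)")
    case True
    obtain t where "g (x + h n *\<^sub>R b) - g (x + 0 *\<^sub>R b) = g' (x + t *\<^sub>R b) ((h n - 0) *\<^sub>R b)"
      using mvt_simple[OF h(1)[of n], of "\<lambda>t. g (x + t *\<^sub>R b)" "\<lambda>t u. g' (x + t *\<^sub>R b) (u *\<^sub>R b)"] line by blast
    then have "s n x = g' (x + t *\<^sub>R b) b"
      using h(1)[of n] by (simp add: s_def lin)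
    then show ?thesis using B' True by simp
  next
    case False
    have "norm x \<le> norm (x + h n *\<^sub>R b) + norm (h n *\<^sub>R b)"
      using norm_triangle_ineq4[of "x + h n *\<^sub>R b" "h n *\<^sub>R b"] by simp
    moreover have "norm (h n *\<^sub>R b) \<le> norm b"
      using h[of n] by (simp add: mult_left_le_one_le)
    ultimately have "x \<notin> K" "x + h n *\<^sub>R b \<notin> K"
      using False R[of x] R[of "x + h n *\<^sub>R b"] norm_ge_zero[of b] by (force simp: not_le)+
    then show ?thesis using zero B by (simp add: s_def)
  qed
  have lim: "(\<lambda>n. s n x) \<longlonglongrightarrow> g' x b" for x
  proof -
    have "((\<lambda>t. g (x + t *\<^sub>R b)) has_real_derivative g' x b) (at 0)"
      using line[of x 0 UNIV] by (simp add: has_field_derivative_def lin mult_commute_abs)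
    then have "((\<lambda>t. (g (x + t *\<^sub>R b) - g x) / t) \<longlongrightarrow> g' x b) (at 0)"
      by (simp add: DERIV_def)
    moreover have "filterlim h (at 0) sequentially"
      using h0 h(1) by (simp add: filterlim_at less_imp_neq[symmetric] order_less_imp_not_eq2)
    ultimately show ?thesis
      unfolding s_def by (rule filterlim_compose)
  qed
  have gint: "integrable lborel g"
    using integrable_continuous_compact_support[OF gcont K zero] .
  have trans: "integrable lborel (\<lambda>x. g (x + c))" "integral\<^sup>L lborel (\<lambda>x. g (x + c)) = integral\<^sup>L lborel g" for c
  proof -
    have [measurable]: "g \<in> borel_measurable borel"
      using gcont borel_measurable_continuous_onI by blast
    show "integral\<^sup>L lborel (\<lambda>x. g (x + c)) = integral\<^sup>L lborel g"
      by (subst (2) lborel_distr_plus[of c, symmetric]) (simp add: integral_distr add.commute)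
    have "integrable (distr lborel borel ((+) c)) g"
      using gint by (simp add: lborel_distr_plus)
    then show "integrable lborel (\<lambda>x. g (x + c))"
      by (simp add: integrable_distr_eq add.commute)
  qed
  have sint: "integral\<^sup>L lborel (s n) = 0" for n
    unfolding s_def using trans gint by simp
  have "(\<lambda>n. integral\<^sup>L lborel (s n)) \<longlonglongrightarrow> integral\<^sup>L lborel (\<lambda>x. g' x b)"
  proof (rule integral_dominated_convergence)
    show "(\<lambda>x. g' x b) \<in> borel_measurable lborel"
      using cont borel_measurable_continuous_onI by simp
    show "s n \<in> borel_measurable lborel" for n
      unfolding s_def by (intro borel_measurable_integrable) (use trans gint in simp)
    show "integrable lborel (\<lambda>x. B * indicator (cball 0 (R + norm b)) x)"
      by (intro integrable_mult_right integrable_real_indicator) (use emeasure_lborel_cball_finite in auto)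
  qed (use bnd lim in auto)
  then show ?thesis
    by (simp add: sint LIMSEQ_const_iff)
qed

section \<open>Sobolev regularity of linear maps\<close>

text \<open>Weak gradients are tested by integrals over the domain, while translation invariance
  lives on the whole space; extension by zero links the two.\<close>

lemma integral_lebesgue_on_eq_lborel:
  fixes f :: "'a::euclidean_space \<Rightarrow> 'b::euclidean_space"
  assumes "S \<in> sets lebesgue" and "f \<in> borel_measurable borel" and "\<And>x. x \<notin> S \<Longrightarrow> f x = 0"
  shows "integral\<^sup>L (lebesgue_on S) f = integral\<^sup>L lborel f"
proof -
  have "(\<lambda>x. indicator S x *\<^sub>R f x) = f"
    using assms(3) by (auto simp: indicator_def fun_eq_iff)
  then have "integral\<^sup>L (lebesgue_on S) f = integral\<^sup>L lebesgue f"
    using assms(1) by (simp add: integral_restrict_space)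
  then show ?thesis
    using assms(2) by (simp add: integral_completion)
qed

lemma continuous_imp_locally_integrable_on:
  fixes f :: "'a::euclidean_space \<Rightarrow> 'b::euclidean_space"
  assumes "continuous_on S f"
  shows "f locally_integrable_on S"
  unfolding locally_integrable_on_def set_integrable_def
proof (intro allI impI)
  fix K assume "compact K \<and> K \<subseteq> S"
  then have "integrable lborel (\<lambda>x. indicator K x *\<^sub>R f x)"
    using assms by (intro borel_integrable_compact) (auto intro: continuous_on_subset)
  then show "integrable lebesgue (\<lambda>x. indicator K x *\<^sub>R f x)"
    by (subst integrable_completion) auto
qed

text \<open>On a set of finite measure the constant \<open>B powr p\<close> is an integrable
  majorant.\<close>

lemma in_Lp_bounded:
  assumes S: "S \<in> lmeasurable" and f: "continuous_on S f" and bdd: "bounded (f ` S)" and p: "p \<ge> 0"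
  shows "in_Lp p S f"
proof -
  interpret finite_measure "lebesgue_on S"
    using S by (rule finite_measure_lebesgue_on)
  have m [measurable]: "f \<in> borel_measurable (lebesgue_on S)"
    using S f by (auto intro: continuous_imp_measurable_on_sets_lebesgue)
  obtain B where B: "\<And>x. x \<in> S \<Longrightarrow> norm (f x) \<le> B"
    using bdd unfolding bounded_iff by auto
  have "integrable (lebesgue_on S) (\<lambda>x. norm (f x) powr p)"
  proof (rule integrable_const_bound)
    show "AE x in lebesgue_on S. norm (norm (f x) powr p) \<le> B powr p"
      using B p by (intro AE_I2) (auto simp: powr_mono2)
  qed measurable
  then show ?thesis using m by (simp add: in_Lp_def)
qed

text \<open>The differentiability and continuity claims are the case \<open>C_k (Suc 0)\<close> of
  smoothness.\<close>

lemma test_functionD: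
  assumes "test_function S \<phi>"
  shows "(\<phi> has_derivative frechet_derivative \<phi> (at x)) (at x)"
    and "continuous_on UNIV (\<lambda>x. frechet_derivative \<phi> (at x) (axis j 1))"
    and "compact (closure {x. \<phi> x \<noteq> 0})" and "closure {x. \<phi> x \<noteq> 0} \<subseteq> S"
proof -
  have "C_k (Suc 0) \<phi>" using assms unfolding test_function_def by blast
  then show "(\<phi> has_derivative frechet_derivative \<phi> (at x)) (at x)"
    and "continuous_on UNIV (\<lambda>x. frechet_derivative \<phi> (at x) (axis j 1))"
    by (auto simp: frechet_derivative_works)
qed (use assms in \<open>auto simp: test_function_def\<close>)

text \<open>The product of a component of \<open>A *v x\<close> with a test function has compact
  support, so its partial derivatives integrate to 0. The product rule splits this integral into the
  two sides of the weak gradient identity.\<close>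

lemma is_weak_gradient_matrix:
  fixes A :: "real^'n^'k"
  assumes S: "S \<in> sets lebesgue"
  shows "is_weak_gradient S (\<lambda>x. A *v x) (\<lambda>_. A)"
  unfolding is_weak_gradient_def
proof (intro conjI allI impI)
  fix \<phi> :: "real^'n \<Rightarrow> real" and i :: 'k and j :: 'n
  assume \<phi>: "test_function S \<phi>"
  note der = test_functionD(1)[OF \<phi>] and cont = test_functionD(2)[OF \<phi>, of j]
    and K = test_functionD(3)[OF \<phi>] and KS = test_functionD(4)[OF \<phi>]
  let ?K = "closure {x. \<phi> x \<noteq> 0}" and ?D = "\<lambda>x. frechet_derivative \<phi> (at x) (axis j 1)"
  have zero: "\<phi> x = 0" if "x \<notin> ?K" for x
    using that closure_subset by force
  have zeroD: "?D x = 0" if "x \<notin> ?K" for x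
    using has_derivative_zero_outside_closed[OF closed_closure zero der[of x] that] by simp
  have contA: "continuous_on UNIV (\<lambda>x. (A *v x) $ i)"
    by (intro continuous_intros linear_continuous_on) (simp add: matrix_vector_mul_bounded_linear)
  have cont\<phi>: "continuous_on UNIV \<phi>"
    by (intro continuous_at_imp_continuous_on ballI has_derivative_continuous[OF der])
  have cont1: "continuous_on UNIV (\<lambda>x. (A *v x) $ i * ?D x)"
    and cont2: "continuous_on UNIV (\<lambda>x. A $ i $ j * \<phi> x)"
    by (intro continuous_intros contA cont cont\<phi>)+
  have int1: "integrable lborel (\<lambda>x. (A *v x) $ i * ?D x)"
    by (rule integrable_continuous_compact_support[OF cont1 K]) (drule zeroD, simp)
  have int2: "integrable lborel (\<lambda>x. A $ i $ j * \<phi> x)"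
    by (rule integrable_continuous_compact_support[OF cont2 K]) (drule zero, simp)
  have derA: "((\<lambda>x. (A *v x) $ i) has_derivative (\<lambda>u. (A *v u) $ i)) (at x)" for x
    using bounded_linear.has_derivative[OF bounded_linear_vec_nth
        bounded_linear.has_derivative[OF matrix_vector_mul_bounded_linear has_derivative_ident]] .
  have axis: "(A *v axis j 1) $ i = A $ i $ j"
    by (simp add: matrix_vector_mult_basis column_def)
  have "integral\<^sup>L lborel (\<lambda>x. (A *v x) $ i * ?D x + (A *v axis j 1) $ i * \<phi> x) = 0"
  proof (rule integral_directional_derivative_eq_0[OF has_derivative_mult[OF derA der] _ K])
    show "continuous_on UNIV (\<lambda>x. (A *v x) $ i * ?D x + (A *v axis j 1) $ i * \<phi> x)"
      unfolding axis by (intro continuous_intros cont1 cont2)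
  qed (drule zero, simp)
  then have "integral\<^sup>L lborel (\<lambda>x. (A *v x) $ i * ?D x) = - integral\<^sup>L lborel (\<lambda>x. A $ i $ j * \<phi> x)"
    using int1 int2 by (simp only: axis Bochner_Integration.integral_add)
  moreover have "(LINT x|lebesgue_on S. (A *v x) $ i * ?D x) = integral\<^sup>L lborel (\<lambda>x. (A *v x) $ i * ?D x)"
    using zeroD[OF contra_subsetD[OF KS]]
    by (intro integral_lebesgue_on_eq_lborel S borel_measurable_continuous_onI cont1) simp
  moreover have "(LINT x|lebesgue_on S. A $ i $ j * \<phi> x) = integral\<^sup>L lborel (\<lambda>x. A $ i $ j * \<phi> x)"
    using zero[OF contra_subsetD[OF KS]]
    by (intro integral_lebesgue_on_eq_lborel S borel_measurable_continuous_onI cont2) simp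
  ultimately show "(LINT x|lebesgue_on S. (A *v x) $ i * ?D x) = - (LINT x|lebesgue_on S. A $ i $ j * \<phi> x)"
    by (simp only:)
qed (auto intro!: continuous_imp_locally_integrable_on intro: linear_continuous_on)

lemma in_W1p_matrix:
  fixes A :: "real^'n^'k"
  assumes S: "open S" "bounded S" and p: "p \<ge> 0"
  shows "in_W1p p S (\<lambda>x. A *v x)"
proof -
  have lm: "S \<in> lmeasurable"
    using S lmeasurable_open by blast
  have "in_Lp p S (\<lambda>x. A *v x)"
    using S(2) p by (intro in_Lp_bounded lm linear_continuous_on bounded_linear_image
        matrix_vector_mul_bounded_linear)
  moreover have "in_Lp p S (\<lambda>_. A)"
    using p by (intro in_Lp_bounded lm) (auto simp: image_constant_conv)
  moreover have "is_weak_gradient S (\<lambda>x. A *v x) (\<lambda>_. A)"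
    using lm by (intro is_weak_gradient_matrix) auto
  ultimately show ?thesis unfolding in_W1p_def by blast
qed

section \<open>Linear maps as admissible deformations\<close>

lemma open_matrix_image:
  fixes A :: "real^'n^'n"
  assumes "det A \<noteq> 0" "open S"
  shows "open ((*v) A ` S)"
  using assms by (intro open_surjective_linear_image)
    (auto simp: matrix_vector_mul_linear invertible_det_nz[symmetric] matrix_right_invertible_surjective[symmetric] invertible_right_inverse)

text \<open>The inverse is again linear, given by the inverse matrix on a bounded open image, so the
  Sobolev bound for linear maps covers both directions.\<close>

lemma orientation_preserving_invertible_matrix:
  fixes A :: "real^'n^'n"
  assumes A: "det A > 0" and S: "open S" "bounded S" and p: "p \<ge> 0"
  shows "orientation_preserving_invertible p S ((*v) A ` S) (\<lambda>x. A *v x) (\<lambda>_. A)"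
  unfolding orientation_preserving_invertible_def
proof (intro conjI)
  obtain B where AB: "A ** B = mat 1" and BA: "B ** A = mat 1"
    using A invertible_det_nz[of A] by (auto simp: invertible_def)
  have "homeomorphism S ((*v) A ` S) (\<lambda>x. A *v x) (\<lambda>x. B *v x)"
    using AB BA by (auto simp: homeomorphism_def matrix_vector_mul_assoc image_image
          matrix_mul_assoc[symmetric]
        intro!: linear_continuous_on matrix_vector_mul_bounded_linear)
  moreover have "in_W1p p S (\<lambda>x. A *v x)"
    using S p by (rule in_W1p_matrix)
  moreover have "in_W1p p ((*v) A ` S) (\<lambda>x. B *v x)"
    using A S p by (intro in_W1p_matrix open_matrix_image bounded_linear_image
        matrix_vector_mul_bounded_linear) auto
  ultimately show "\<exists>z. homeomorphism S ((*v) A ` S) (\<lambda>x. A *v x) z \<and> in_W1p p S (\<lambda>x. A *v x) \<and>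
      in_W1p p ((*v) A ` S) z"
    by blast
  show "is_weak_gradient S (\<lambda>x. A *v x) (\<lambda>_. A)"
    using S by (intro is_weak_gradient_matrix) auto
qed (use A in simp)

section \<open>Rotations and the determinant\<close>

lemma det_rotation_conjugate:
  assumes "rotation_matrix Q" "rotation_matrix R"
  shows "det (Q ** A ** R) = det A"
  using assms by (simp add: rotation_matrix_def det_mul)

lemma rotation_matrix_transpose: "rotation_matrix (transpose R) \<longleftrightarrow> rotation_matrix R"
  by (simp add: rotation_matrix_def orthogonal_matrix_transpose)

section \<open>Bounded convex open sets are Lipschitz domains\<close>

text \<open>The graph function near \<open>x0\<close> is the infimal convolution \<open>\<gamma>\<close> of the domain with a steep cone of slope
  \<open>L\<close> around the direction \<open>e\<close> from \<open>x0\<close> to an interior point \<open>z\<close>; this makes it Lipschitz on the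
  whole hyperplane. The slope is so large that a ray of the cone starting in the domain and passing
  near \<open>x0\<close> goes on to meet the ball around \<open>z\<close>, so by convexity the epigraph of \<open>\<gamma>\<close> stays inside.\<close>

lemma convex_imp_lipschitz_domain:
  fixes \<Omega> :: "(real^'n) set"
  assumes conv: "convex \<Omega>" and opn: "open \<Omega>" and bdd: "bounded \<Omega>" and ne: "\<Omega> \<noteq> {}"
  shows "lipschitz_domain \<Omega>"
  unfolding lipschitz_domain_def
proof (intro conjI ballI)
  fix x0 assume "x0 \<in> frontier \<Omega>"
  then have x0: "x0 \<notin> \<Omega>"
    using opn by (simp add: frontier_def interior_open)
  obtain z \<rho> where \<rho>: "\<rho> > 0" and ball: "ball z \<rho> \<subseteq> \<Omega>"
    using ne opn open_contains_ball by blast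
  define d where "d = norm (z - x0)"
  have d\<rho>: "\<rho> \<le> d"
    using x0 ball by (force simp: d_def dist_norm)
  define e where "e = (z - x0) /\<^sub>R d"
  \<comment> \<open>Chosen so that \<open>L * (\<rho> / 2) = 2 * d\<close>, where
    \<open>2 * d\<close> will bound the height from a point near \<open>x0\<close> up to
    \<open>z\<close>.\<close>
  define L where "L = 4 * d / \<rho>"
  have d: "d > 0" and L: "L > 0"
    using \<rho> d\<rho> by (auto simp: L_def)
  have e1: "norm e = 1"
    using d by (simp add: e_def d_def)
  then have ee: "e \<bullet> e = 1" by (simp add: norm_eq_1)
  have z: "z = x0 + d *\<^sub>R e"
    using d by (simp add: e_def)
  define P where "P x = x - (x \<bullet> e) *\<^sub>R e" for x
  have Padd: "P (x + y) = P x + P y" and Pdiff: "P (x - y) = P x - P y" and Psc: "P (a *\<^sub>R x) = a *\<^sub>R P x" for x y a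
    by (simp_all add: P_def algebra_simps)
  have Pe: "P e = 0" using ee by (simp add: P_def)
  have Ple: "norm (P x) \<le> norm x" for x
  proof -
    have "norm (P x) ^ 2 = norm x ^ 2 - (x \<bullet> e) ^ 2"
      unfolding P_def power2_norm_eq_inner using ee
      by (simp add: inner_diff_left inner_diff_right inner_commute power2_eq_square)
    then have "norm (P x) ^ 2 \<le> norm x ^ 2" by simp
    then show ?thesis by (rule power2_le_imp_le) simp
  qed
  have ele: "\<bar>x \<bullet> e\<bar> \<le> norm x" for x
    using Cauchy_Schwarz_ineq2[of x e] e1 by simp
  \<comment> \<open>\<open>F h w\<close> is the height above the horizontal position
    \<open>h\<close> of the upward cone of slope \<open>L\<close> with apex
    \<open>w\<close>.\<close>
  define F where "F h w = w \<bullet> e + L * norm (h - P w)" for h w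
  define \<gamma> where "\<gamma> h = (INF w\<in>\<Omega>. F h w)" for h
  obtain M where M: "\<And>x. x \<in> \<Omega> \<Longrightarrow> norm x \<le> M"
    using bdd unfolding bounded_iff by blast
  \<comment> \<open>Boundedness of the domain bounds the cone heights below, so the real infimum
    \<open>\<gamma>\<close> is a genuine one.\<close>
  have "- M \<le> F h w" if "w \<in> \<Omega>" for h w
  proof -
    have "0 \<le> L * norm (h - P w)" using L by simp
    then show ?thesis using ele[of w] M[OF that] unfolding F_def by linarith
  qed
  then have bb: "bdd_below (F h ` \<Omega>)" for h by (meson bdd_belowI2)
  \<comment> \<open>Each cone is \<open>L\<close>-Lipschitz in \<open>h\<close>, and an infimum of
    such functions keeps the constant.\<close>
  have step: "\<gamma> h \<le> \<gamma> h' + L * norm (h - h')" for h h'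
  proof -
    have "\<gamma> h - L * norm (h - h') \<le> \<gamma> h'"
      unfolding \<gamma>_def[of h']
    proof (rule cINF_greatest[OF ne])
      fix w assume w: "w \<in> \<Omega>"
      have "norm (h - P w) \<le> norm (h - h') + norm (h' - P w)"
        using norm_triangle_ineq[of "h - h'" "h' - P w"] by simp
      then have "L * norm (h - P w) \<le> L * norm (h - h') + L * norm (h' - P w)"
        using mult_left_mono[of _ _ L] L by (simp add: distrib_left[symmetric])
      moreover have "\<gamma> h \<le> F h w"
        unfolding \<gamma>_def using bb w by (rule cINF_lower)
      ultimately show "\<gamma> h - L * norm (h - h') \<le> F h' w"
        unfolding F_def by linarith
    qed
    then show ?thesis by simp
  qed
  have lip: "L-lipschitz_on {z. z \<bullet> e = 0} \<gamma>"
  proof (rule lipschitz_onI)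
    fix h h' show "dist (\<gamma> h) (\<gamma> h') \<le> L * dist h h'"
      using step[of h h'] step[of h' h] by (simp add: dist_norm norm_minus_commute abs_le_iff)
  qed (use L in simp)
  have iff: "x \<in> \<Omega> \<longleftrightarrow> \<gamma> (P x) < x \<bullet> e" if x: "x \<in> ball x0 (\<rho> / 2)" for x
  proof
    assume xO: "x \<in> \<Omega>"
    obtain \<epsilon> where \<epsilon>: "\<epsilon> > 0" "cball x \<epsilon> \<subseteq> \<Omega>"
      using opn xO open_contains_cball by blast
    \<comment> \<open>A point of the domain strictly below \<open>x\<close>: its cone has height
      \<open>x \<bullet> e - \<epsilon>\<close> over \<open>P x\<close>, which makes the inequality
      strict.\<close>
    define w where "w = x - \<epsilon> *\<^sub>R e"
    have "w \<in> \<Omega>" using \<epsilon> e1 by (auto simp: w_def dist_norm)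
    then have "\<gamma> (P x) \<le> F (P x) w"
      unfolding \<gamma>_def by (rule cINF_lower[OF bb])
    also have "F (P x) w = x \<bullet> e - \<epsilon>"
      using ee by (simp add: F_def w_def Pdiff Psc Pe inner_diff_left)
    finally show "\<gamma> (P x) < x \<bullet> e" using \<epsilon> by simp
  next
    assume "\<gamma> (P x) < x \<bullet> e"
    then obtain w where w: "w \<in> \<Omega>" "F (P x) w < x \<bullet> e"
      unfolding \<gamma>_def using cINF_less_iff[OF ne bb] by blast
    define v where "v = x - w"
    have vL: "L * norm (P v) < v \<bullet> e"
      using w(2) by (simp add: F_def v_def Pdiff inner_diff_left)
    have v0: "v \<bullet> e > 0"
      using vL L le_less_trans[of 0 "L * norm (P v)"] by simp
    have xx0: "norm (x - x0) < \<rho> / 2"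
      using x by (simp add: dist_norm norm_minus_commute)
    \<comment> \<open>\<open>a\<close> is the height of \<open>z\<close> over \<open>x\<close>. The
      parameter \<open>t\<close> below extends the ray from \<open>w\<close> through
      \<open>x\<close> to the point \<open>q\<close> at the level of \<open>z\<close>.\<close>
    define a where "a = (z - x) \<bullet> e"
    have aeq: "a = d - (x - x0) \<bullet> e"
      using ee by (simp add: a_def z inner_diff_left inner_add_left)
    have a: "0 \<le> a" "a < 2 * d"
      using aeq ele[of "x - x0"] xx0 \<rho> d\<rho> by linarith+
    define t where "t = a / (v \<bullet> e)"
    have t: "t \<ge> 0" using a v0 by (simp add: t_def)
    have tv: "t * (v \<bullet> e) = a" using v0 by (simp add: t_def)
    define q where "q = x + t *\<^sub>R v"
    have "(q - z) \<bullet> e = 0"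
      using tv by (simp add: q_def a_def inner_diff_left inner_add_left)
    then have "q - z = P (q - z)" by (simp add: P_def)
    also have "\<dots> = P (x - x0) + t *\<^sub>R P v"
      by (simp add: q_def z Padd Pdiff Psc Pe)
    finally have "norm (q - z) \<le> norm (P (x - x0)) + t * norm (P v)"
      using t norm_triangle_ineq[of "P (x - x0)" "t *\<^sub>R P v"] by simp
    \<comment> \<open>As the ray rises more steeply than \<open>L\<close>, gaining height
      \<open>a < 2 * d\<close> moves it horizontally by at most \<open>\<rho> / 2\<close>. The
      projected offset of \<open>x\<close> from \<open>x0\<close> is below \<open>\<rho> / 2\<close>
      too, so \<open>q\<close> lands in the ball around \<open>z\<close>.\<close>
    moreover have "t * norm (P v) \<le> \<rho> / 2"
    proof -
      have "L * (t * norm (P v)) \<le> a"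
        using mult_left_mono[OF less_imp_le[OF vL] t] tv by (simp add: mult_ac)
      also have "\<dots> \<le> L * (\<rho> / 2)" using a \<rho> by (simp add: L_def)
      finally show ?thesis using L by simp
    qed
    ultimately have "norm (q - z) < \<rho>" using Ple[of "x - x0"] xx0 by linarith
    then have q: "q \<in> \<Omega>" using ball by (auto simp: dist_norm norm_minus_commute)
    \<comment> \<open>\<open>x\<close> lies on the segment from \<open>w\<close> to
      \<open>q\<close>, both in the domain, so convexity applies; \<open>t = 0\<close> gives
      \<open>x = q\<close>.\<close>
    have "x = (1 / (1 + t)) *\<^sub>R q + (t / (1 + t)) *\<^sub>R w"
    proof -
      have "(1 + t) *\<^sub>R x = q + t *\<^sub>R w"
        by (simp add: q_def v_def algebra_simps)
      then have "(1 / (1 + t)) *\<^sub>R (1 + t) *\<^sub>R x = (1 / (1 + t)) *\<^sub>R (q + t *\<^sub>R w)" by simp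
      then show ?thesis using t by (simp add: scaleR_add_right)
    qed
    moreover have "(1 / (1 + t)) + (t / (1 + t)) = 1"
      using t by (simp add: add_divide_distrib[symmetric])
    ultimately show "x \<in> \<Omega>"
      using convexD[OF conv q w(1), of "1 / (1 + t)" "t / (1 + t)"] t by simp
  qed
  show "\<exists>r>0. \<exists>e \<gamma> L. norm e = 1 \<and> L-lipschitz_on {z. z \<bullet> e = 0} \<gamma> \<and>
        \<Omega> \<inter> ball x0 r = {x \<in> ball x0 r. \<gamma> (x - (x \<bullet> e) *\<^sub>R e) < x \<bullet> e}"
    using \<rho> e1 lip iff unfolding P_def
    by (intro exI[of _ "\<rho> / 2"] exI[of _ e] exI[of _ \<gamma>] exI[of _ L] conjI) auto
qed (use assms convex_connected in auto)

section \<open>Rotation invariance of the integrals and isotropy\<close>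

theorem proposition1:
  fixes \<psi> :: "real^'m \<Rightarrow> real^'m \<Rightarrow> real^'n^'n \<Rightarrow> real" and p :: real
  assumes p: "p > real CARD('n)"
    and nonneg: "\<And>a b A. A \<in> Mplus \<Longrightarrow> \<psi> a b A \<ge> 0"
    and measurable: "(\<lambda>(a, b, A). \<psi> a b A)
          \<in> borel_measurable (restrict_space borel (UNIV \<times> UNIV \<times> Mplus))"
  shows "(\<forall>(R1 :: real^'n^'n) (R2 :: real^'n^'n)
            (\<Omega>1 :: (real^'n) set) (c1 :: real^'n \<Rightarrow> real^'m)
            (\<Omega>2 :: (real^'n) set) (c2 :: real^'n \<Rightarrow> real^'m)
            (y :: real^'n \<Rightarrow> real^'n) (Dy :: real^'n \<Rightarrow> real^'n^'n).
            rotation_matrix R1 \<longrightarrow> rotation_matrix R2 \<longrightarrow>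
            is_image \<Omega>1 c1 \<longrightarrow> is_image \<Omega>2 c2 \<longrightarrow>
            orientation_preserving_invertible p \<Omega>1 \<Omega>2 y Dy \<longrightarrow>
            (\<integral>\<^sup>+x. ennreal (\<psi> (c1 x) (c2 (y x)) (R2 ** Dy x ** transpose R1)) \<partial>lebesgue_on \<Omega>1) =
            (\<integral>\<^sup>+x. ennreal (\<psi> (c1 x) (c2 (y x)) (Dy x)) \<partial>lebesgue_on \<Omega>1))
         \<longleftrightarrow> (\<forall>a b. isotropic (\<psi> a b))" (is "?L \<longleftrightarrow> _")
proof
  assume iso: "\<forall>a b. isotropic (\<psi> a b)"
  show ?L
  proof (intro allI impI)
    fix R1 R2 :: "real^'n^'n" and \<Omega>1 \<Omega>2 :: "(real^'n) set" and c1 c2 :: "real^'n \<Rightarrow> real^'m"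
      and y :: "real^'n \<Rightarrow> real^'n" and Dy :: "real^'n \<Rightarrow> real^'n^'n"
    assume R: "rotation_matrix R1" "rotation_matrix R2"
      and "orientation_preserving_invertible p \<Omega>1 \<Omega>2 y Dy"
    then have "AE x in lebesgue_on \<Omega>1. det (Dy x) > 0"
      by (simp add: orientation_preserving_invertible_def)
    then show "(\<integral>\<^sup>+x. ennreal (\<psi> (c1 x) (c2 (y x)) (R2 ** Dy x ** transpose R1)) \<partial>lebesgue_on \<Omega>1) =
        (\<integral>\<^sup>+x. ennreal (\<psi> (c1 x) (c2 (y x)) (Dy x)) \<partial>lebesgue_on \<Omega>1)"
    proof (intro nn_integral_cong_AE, eventually_elim)
      case (elim x)
      then have "Dy x \<in> Mplus" by (simp add: Mplus_def)
      then show ?case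
        using iso R rotation_matrix_transpose unfolding isotropic_def by metis
    qed
  qed
next
  assume L: ?L
  show "\<forall>a b. isotropic (\<psi> a b)"
    unfolding isotropic_def
  proof (intro allI ballI impI)
    fix a b :: "real^'m" and A Q R :: "real^'n^'n"
    assume A: "A \<in> Mplus" and Q: "rotation_matrix Q" and R: "rotation_matrix R"
    define \<Omega>1 :: "(real^'n) set" where "\<Omega>1 = ball 0 1"
    define \<Omega>2 where "\<Omega>2 = (*v) A ` \<Omega>1"
    have det: "det A > 0" using A by (simp add: Mplus_def)
    have 1: "is_image \<Omega>1 (\<lambda>_. a)"
      by (auto simp: is_image_def \<Omega>1_def intro!: convex_imp_lipschitz_domain)
    have 2: "is_image \<Omega>2 (\<lambda>_. b)"
      using det unfolding is_image_def \<Omega>2_def \<Omega>1_def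
      by (intro conjI convex_imp_lipschitz_domain bounded_linear_image convex_linear_image
          open_matrix_image matrix_vector_mul_bounded_linear matrix_vector_mul_linear) auto
    have 3: "orientation_preserving_invertible p \<Omega>1 \<Omega>2 (\<lambda>x. A *v x) (\<lambda>_. A)"
      unfolding \<Omega>2_def using det p
      by (intro orientation_preserving_invertible_matrix) (auto simp: \<Omega>1_def)
    \<comment> \<open>Taking \<open>R1 = transpose R\<close> and \<open>R2 = Q\<close> makes the
      rotated argument exactly \<open>Q ** A ** R\<close>, since the identity transposes
      \<open>R1\<close> once more.\<close>
    have "rotation_matrix (transpose R)" using R by (simp add: rotation_matrix_transpose)
    from L[rule_format, OF this Q 1 2 3]
    have eq: "ennreal (\<psi> a b (Q ** A ** R)) * emeasure (lebesgue_on \<Omega>1) (space (lebesgue_on \<Omega>1)) =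
        ennreal (\<psi> a b A) * emeasure (lebesgue_on \<Omega>1) (space (lebesgue_on \<Omega>1))"
      by simp
    \<comment> \<open>Cancelling the common factor in \<open>ennreal\<close> requires the measure of
      the ball to be neither 0 nor infinite.\<close>
    have "emeasure (lebesgue_on \<Omega>1) (space (lebesgue_on \<Omega>1)) = emeasure lborel (ball (0::real^'n) 1)"
      by (simp add: \<Omega>1_def emeasure_restrict_space)
    moreover have "emeasure lborel (ball (0::real^'n) 1) \<noteq> 0" "emeasure lborel (ball (0::real^'n) 1) \<noteq> \<infinity>"
      using emeasure_bounded_finite[of "ball (0::real^'n) 1"] content_ball_pos[of 1 "0::real^'n"]
      by (auto simp: measure_def)
    ultimately have "ennreal (\<psi> a b (Q ** A ** R)) = ennreal (\<psi> a b A)"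
      using eq by (simp add: ennreal_mult_cancel_left mult.commute[of "ennreal _"])
    \<comment> \<open>\<open>ennreal\<close> sends all negative reals to 0, so recovering equality
      of reals uses nonnegativity of \<open>\<psi>\<close> at both matrices, which is given on
      \<open>Mplus\<close>.\<close>
    moreover have "Q ** A ** R \<in> Mplus"
      using A Q R by (simp add: Mplus_def det_rotation_conjugate)
    ultimately show "\<psi> a b (Q ** A ** R) = \<psi> a b A"
      using A nonneg by simp
  qed
qed

end
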